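(* The expectation of the number $X_n$ of swaps of Quicksort for a list of length $n$ under Variant III (Lomuto partition scheme) is $$E[X_n]=(n+1)H_1(n)-\frac43 n-\frac13.$$
   Context: $H_1(n)=\sum_{i=1}^n \frac1i$. Variant III is in-place Quicksort with the Lomuto partition scheme, applied to a uniformly random ordering of $n$ distinct elements. To partition $A[s..t]$ (with $s<t$): set pivot $:=A[t]$, $i:=s$; for $j$ from $s$ to $t-1$, if $A[j]<$ pivot then swap $A[i]$ with $A[j]$ and set $i:=i+1$; finally swap $A[i]$ with $A[t]$. Then recurse on $A[s..i-1]$ and $A[i+1..t]$; nothing is done when $s\ge t$. Every executed swap instruction counts as one swap (even if both indices coincide), so partitioning costs $k$ swaps when the pivot is the $k$-th smallest. $X_n$ is the total number of swaps. Its probability generating function $P_n(t)=\sum_{m\ge0}P(X_n=m)t^m$ satisfies the recurrence $P_n(t)=\frac1n\sum_{k=1}^nP_{k-1}(t)P_{n-k}(t)\,t^k$ with the initial condition $P_0(t)=P_1(t)=1$.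
   Formalization: The formula is proved for n ≥ 2 only: for n = 0 and n = 1 no swap is made, so the expectation is 0, whereas the printed formula gives −1/3 and 1/3. *)

theory Defs
  imports "HOL-Probability.Probability" "HOL-Combinatorics.Multiset_Permutations"
    "HOL-Analysis.Harmonic_Numbers"
begin

text \<open>
  Arrays are lists, indexed from 0.  The algorithms below return the updated array together with
  the number of swap instructions executed; a swap with coinciding indices is counted as well.
\<close>

definition swap_at :: "'a list \<Rightarrow> nat \<Rightarrow> nat \<Rightarrow> 'a list" where
  "swap_at A i j = A[i := A ! j, j := A ! i]"

text \<open>State of the partition loop: (array, index \<open>i\<close>, number of swaps so far).\<close>

fun lomuto_step :: "'a::linorder \<Rightarrow> nat \<Rightarrow> 'a list \<times> nat \<times> nat \<Rightarrow> 'a list \<times> nat \<times> nat" where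
  "lomuto_step pivot j (A, i, c) =
     (if A ! j < pivot then (swap_at A i j, i + 1, c + 1) else (A, i, c))"

definition lomuto_partition :: "'a::linorder list \<Rightarrow> nat \<Rightarrow> nat \<Rightarrow> 'a list \<times> nat \<times> nat" where
  "lomuto_partition A s t =
     (let (B, i, c) = fold (lomuto_step (A ! t)) [s..<t] (A, s, 0)
      in (swap_at B i t, i, c + 1))"

lemma fold_lomuto_step_bounds:
  assumes "fold (lomuto_step p) js (A, i, c) = (B, i', c')"
  shows "i \<le> i' \<and> i' \<le> i + length js"
  using assms
proof (induction js arbitrary: A i c)
  case Nil
  then show ?case by simp
next
  case (Cons j js)
  show ?case
  proof (cases "A ! j < p")
    case True
    with Cons.prems have "fold (lomuto_step p) js (swap_at A i j, i + 1, c + 1) = (B, i', c')"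
      by simp
    from Cons.IH[OF this] show ?thesis by simp
  next
    case False
    with Cons.prems have "fold (lomuto_step p) js (A, i, c) = (B, i', c')"
      by simp
    from Cons.IH[OF this] show ?thesis by simp
  qed
qed

lemma lomuto_partition_bounds:
  assumes "lomuto_partition A s t = (B, i, c)" "s \<le> t"
  shows "s \<le> i" "i \<le> t"
proof -
  obtain B' i' c' where *: "fold (lomuto_step (A ! t)) [s..<t] (A, s, 0) = (B', i', c')"
    by (metis prod_cases3)
  with assms have "i' = i" by (simp add: lomuto_partition_def)
  with fold_lomuto_step_bounds[OF *] assms(2) show "s \<le> i" "i \<le> t" by simp_all
qed

text \<open>
  The subtraction \<open>i - 1\<close> truncates only for \<open>i = s = 0\<close>; the call on the empty range is then
  \<open>lomuto_quicksort B 0 0\<close>, which does nothing, as required.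
\<close>

function lomuto_quicksort :: "'a::linorder list \<Rightarrow> nat \<Rightarrow> nat \<Rightarrow> 'a list \<times> nat" where
  "lomuto_quicksort A s t =
     (if s < t then
        (let (B, i, c) = lomuto_partition A s t;
             (C, cl) = lomuto_quicksort B s (i - 1);
             (D, cr) = lomuto_quicksort C (i + 1) t
         in (D, c + cl + cr))
      else (A, 0))"
  by pat_completeness auto
termination
proof (relation "Wellfounded.measure (\<lambda>(A, s, t). t - s)", goal_cases)
  case 1
  show ?case by simp
next
  case (2 A s t x B y i c)
  then have "lomuto_partition A s t = (B, i, c)" by simp
  from lomuto_partition_bounds[OF this] 2 show ?case by auto
next
  case (3 A s t x B y i c z C cl)
  then have "lomuto_partition A s t = (B, i, c)" by simp
  from lomuto_partition_bounds[OF this] 3 show ?case by auto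
qed

declare lomuto_quicksort.simps [simp del]

definition quicksort_swaps :: "'a::linorder list \<Rightarrow> nat" where
  "quicksort_swaps A = snd (lomuto_quicksort A 0 (length A - 1))"

end

theory Submission imports Defs begin

text \<open>
  Condition on the pivot, which is the last entry of a random permutation and hence has every rank
  with equal probability.  If the pivot is the \<open>k\<close>-th smallest, partitioning costs \<open>k\<close> swaps, and
  the two ranges handed to the recursive calls are independent uniformly random permutations of
  the elements below and above the pivot.  The mean number \<open>e\<close> of swaps therefore satisfies
  \<open>n * e n = (\<Sum>k<n. (k + 1) + e k + e (n - 1 - k))\<close> with \<open>e 0 = e 1 = 0\<close>, whose solution is the
  claimed closed form.

  The point that needs an argument is that Lomuto's partition preserves randomness, as it permutes
  the large elements while scanning.  Seen as a list, the block of large elements either receives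
  a new large element at its end or, when a small element is swapped in front of it, is rotated
  by one position.  Rotation is a bijection on the permutations of a set, so uniformity
  survives each step (\<open>lomuto_split_uniform\<close>).  This is combined with the locality of the in-place
  algorithm: its behaviour on a range depends only on the entries in that range, so the
  swaps of a recursive call are those of a run on a separate array (\<open>quicksort_swaps_snoc\<close>).

  Expectations appear as sums over all permutations, since these can be split by the last entry
  without dividing by cardinalities.
\<close>

section \<open>Lomuto partition as a list function\<close>

text \<open>
  The block of large elements in the middle of the array once the loop has scanned \<open>ys\<close>.  The small
  elements keep their relative order, so the corresponding block of small elements is just
  \<open>filter (\<lambda>y. y < p) ys\<close>.
\<close>

definition lomuto_large :: "'a::linorder \<Rightarrow> 'a list \<Rightarrow> 'a list" where
  "lomuto_large p ys = fold (\<lambda>y R. if y < p then rotate1 R else R @ [y]) ys []"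

lemma lomuto_large_Nil [simp]: "lomuto_large p [] = []"
  by (simp add: lomuto_large_def)

lemma lomuto_large_snoc [simp]:
  "lomuto_large p (ys @ [y]) =
     (if y < p then rotate1 (lomuto_large p ys) else lomuto_large p ys @ [y])"
  by (simp add: lomuto_large_def)

lemma length_lomuto_split:
  "length (filter (\<lambda>y. y < p) ys) + length (lomuto_large p ys) = length ys"
  by (induction ys rule: rev_induct) auto

text \<open>
  The array has the form: small elements \<open>us\<close>, large elements \<open>R\<close>, next entry \<open>y\<close>.  Exchanging \<open>y\<close>
  with the head of \<open>R\<close> moves that head behind the tail of \<open>R\<close>.  If \<open>R\<close> is empty, both indices
  coincide and nothing moves, which agrees with \<open>rotate1 [] = []\<close>.  The same lemma serves for the
  final swap, where \<open>y\<close> is the pivot.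
\<close>

lemma swap_at_rotates_block:
  "swap_at (us @ R @ y # zs) (length us) (length us + length R) = us @ y # rotate1 R @ zs"
  by (cases R) (auto simp: swap_at_def nth_append list_update_append)

lemma lomuto_loop:
  "fold (lomuto_step p) [length xs..<length xs + length ys] (xs @ ys @ zs, length xs, 0) =
     (xs @ filter (\<lambda>y. y < p) ys @ lomuto_large p ys @ zs,
      length xs + length (filter (\<lambda>y. y < p) ys), length (filter (\<lambda>y. y < p) ys))"
proof (induction ys arbitrary: zs rule: rev_induct)
  case Nil
  then show ?case by simp
next
  case (snoc y ys)
  let ?L = "filter (\<lambda>y. y < p) ys" and ?R = "lomuto_large p ys"
  let ?A = "xs @ ?L @ ?R @ y # zs"
  \<comment> \<open>The scanned part of the array is exactly the two blocks, so the loop index points to \<open>y\<close>.\<close>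
  have j: "length xs + length ys = length (xs @ ?L) + length ?R"
    using length_lomuto_split[of p ys] by simp
  have "?A ! (length xs + length ys) = y"
    unfolding j by (simp add: nth_append)
  moreover have "swap_at ?A (length xs + length ?L) (length xs + length ys) =
      xs @ ?L @ y # rotate1 ?R @ zs"
    unfolding j using swap_at_rotates_block[of "xs @ ?L" ?R y zs] by simp
  ultimately show ?case
    using snoc.IH[of "y # zs"] by simp
qed

lemma lomuto_partition_segment:
  "lomuto_partition (xs @ ys @ p # zs) (length xs) (length xs + length ys) =
     (xs @ filter (\<lambda>y. y < p) ys @ p # rotate1 (lomuto_large p ys) @ zs,
      length xs + length (filter (\<lambda>y. y < p) ys), length (filter (\<lambda>y. y < p) ys) + 1)"
proof -
  let ?L = "filter (\<lambda>y. y < p) ys" and ?R = "lomuto_large p ys"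
  have j: "length xs + length ys = length (xs @ ?L) + length ?R"
    using length_lomuto_split[of p ys] by simp
  have "swap_at (xs @ ?L @ ?R @ p # zs) (length xs + length ?L) (length xs + length ys) =
      xs @ ?L @ p # rotate1 ?R @ zs"
    unfolding j using swap_at_rotates_block[of "xs @ ?L" ?R p zs] by simp
  moreover have "(xs @ ys @ p # zs) ! (length xs + length ys) = p"
    by (simp add: nth_append)
  ultimately show ?thesis
    by (simp add: lomuto_partition_def lomuto_loop)
qed

section \<open>Locality of the in-place recursion\<close>

lemma lomuto_quicksort_step:
  fixes p :: "'a::linorder" and us :: "'a list"
  assumes "us \<noteq> []"
  defines "L \<equiv> filter (\<lambda>y. y < p) us" and "R \<equiv> rotate1 (lomuto_large p us)"
  shows "lomuto_quicksort (xs @ us @ p # zs) (length xs) (length xs + length us) =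
    (let (C, cl) = lomuto_quicksort (xs @ L @ p # R @ zs) (length xs) (length xs + length L - 1);
         (D, cr) = lomuto_quicksort C (length xs + length L + 1) (length xs + length us)
     in (D, length L + 1 + cl + cr))"
proof -
  have "length xs < length xs + length us"
    using assms(1) by simp
  then show ?thesis
    unfolding L_def R_def
    by (subst lomuto_quicksort.simps) (simp only: lomuto_partition_segment if_True Let_def split)
qed

text \<open>
  The array and the count produced on a range are those of the range alone: \<open>ys'\<close> and \<open>c\<close> do not
  depend on the surroundings \<open>xs\<close> and \<open>zs\<close>.  The length of \<open>ys'\<close> has to be carried along because
  the second recursive call runs on the array left behind by the first one.
\<close>

lemma lomuto_quicksort_local:
  "\<exists>ys' c. length ys' = length ys \<and>
     (\<forall>xs zs. lomuto_quicksort (xs @ ys @ zs) (length xs) (length xs + length ys - 1) =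
       (xs @ ys' @ zs, c))"
proof (induction "length ys" arbitrary: ys rule: less_induct)
  case less
  show ?case
  proof (cases "length ys < 2")
    case True
    then have "lomuto_quicksort (xs @ ys @ zs) (length xs) (length xs + length ys - 1) =
        (xs @ ys @ zs, 0)" for xs zs
      by (subst lomuto_quicksort.simps) auto
    then show ?thesis by blast
  next
    case False
    then obtain us p where ys: "ys = us @ [p]" and us: "us \<noteq> []"
      by (cases ys rule: rev_cases) auto
    define L where "L = filter (\<lambda>y. y < p) us"
    define R where "R = rotate1 (lomuto_large p us)"
    have len: "length L + length R = length us"
      unfolding L_def R_def using length_lomuto_split[of p us] by simp
    obtain L' cl where L': "length L' = length L"
      "\<And>xs zs. lomuto_quicksort (xs @ L @ zs) (length xs) (length xs + length L - 1) =
         (xs @ L' @ zs, cl)"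
      using less[of L] len ys by auto
    obtain R' cr where R': "length R' = length R"
      "\<And>xs zs. lomuto_quicksort (xs @ R @ zs) (length xs) (length xs + length R - 1) =
         (xs @ R' @ zs, cr)"
      using less[of R] len ys by auto
    have "lomuto_quicksort (xs @ ys @ zs) (length xs) (length xs + length ys - 1) =
       (xs @ (L' @ p # R') @ zs, length L + 1 + cl + cr)" for xs zs
    proof -
      have "lomuto_quicksort (xs @ L' @ p # R @ zs) (length xs + length L + 1) (length xs + length us) =
         (xs @ L' @ p # R' @ zs, cr)"
        using R'(2)[of "xs @ L' @ [p]" zs] L'(1) by (simp add: add.assoc flip: len)
      then show ?thesis
        using lomuto_quicksort_step[OF us, of xs p zs] L'(2)[of xs "p # R @ zs"]
        by (simp add: ys flip: L_def R_def)
    qed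
    moreover have "length (L' @ p # R') = length ys"
      using L'(1) R'(1) len ys by simp
    ultimately show ?thesis by blast
  qed
qed

text \<open>
  The recursive calls act on ranges of one array, but by locality their costs are those of
  independent runs on \<open>L\<close> and \<open>R\<close>.
\<close>

lemma quicksort_swaps_snoc:
  fixes p :: "'a::linorder" and us :: "'a list"
  assumes "us \<noteq> []"
  defines "L \<equiv> filter (\<lambda>y. y < p) us" and "R \<equiv> rotate1 (lomuto_large p us)"
  shows "quicksort_swaps (us @ [p]) = length L + 1 + quicksort_swaps L + quicksort_swaps R"
proof -
  have segment: "\<exists>ys'. length ys' = length ys \<and>
      (\<forall>xs zs. lomuto_quicksort (xs @ ys @ zs) (length xs) (length xs + length ys - 1) =
        (xs @ ys' @ zs, quicksort_swaps ys))" for ys :: "'a list"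
  proof -
    obtain ys' c where ys': "length ys' = length ys"
      "\<And>xs zs. lomuto_quicksort (xs @ ys @ zs) (length xs) (length xs + length ys - 1) =
         (xs @ ys' @ zs, c)"
      using lomuto_quicksort_local[of ys] by blast
    have "quicksort_swaps ys = c"
      using ys'(2)[of "[]" "[]"] by (simp add: quicksort_swaps_def)
    then show ?thesis
      using ys' by blast
  qed
  obtain L' where L': "length L' = length L"
    "\<And>xs zs. lomuto_quicksort (xs @ L @ zs) (length xs) (length xs + length L - 1) =
       (xs @ L' @ zs, quicksort_swaps L)"
    using segment[of L] by blast
  obtain R' where R': "\<And>xs zs. lomuto_quicksort (xs @ R @ zs) (length xs)
      (length xs + length R - 1) = (xs @ R' @ zs, quicksort_swaps R)"
    using segment[of R] by blast
  have len: "length L + length R = length us"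
    unfolding L_def R_def using length_lomuto_split[of p us] by simp
  have left: "lomuto_quicksort (L @ p # R) 0 (length L - Suc 0) = (L' @ p # R, quicksort_swaps L)"
    using L'(2)[of "[]" "p # R"] by simp
  have right: "lomuto_quicksort (L' @ p # R) (Suc (length L)) (length us) =
      (L' @ p # R', quicksort_swaps R)"
    using R'[of "L' @ [p]" "[]"] L'(1) by (simp flip: len)
  show ?thesis
    using lomuto_quicksort_step[OF assms(1), of "[]" p "[]"]
    by (simp add: quicksort_swaps_def[of "us @ [p]"] left right flip: L_def R_def)
qed

section \<open>Partitioning preserves randomness\<close>

lemma sum_permutations_of_set_by_last:
  fixes f :: "'a list \<Rightarrow> 'b::comm_monoid_add"
  assumes "finite S" and "S \<noteq> {}"
  shows "(\<Sum>A\<in>permutations_of_set S. f A) =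
           (\<Sum>x\<in>S. \<Sum>ys\<in>permutations_of_set (S - {x}). f (ys @ [x]))"
proof -
  have "(\<Sum>A\<in>permutations_of_set S. f A) = (\<Sum>A\<in>permutations_of_set S. f (rev A))"
    by (rule sum.reindex_bij_witness[of _ rev rev]) (auto simp: permutations_of_set_def)
  also have "\<dots> = (\<Sum>x\<in>S. \<Sum>A\<in>(#) x ` permutations_of_set (S - {x}). f (rev A))"
    unfolding permutations_of_set_nonempty[OF assms(2)]
    using assms(1) by (intro sum.UNION_disjoint) auto
  also have "\<dots> = (\<Sum>x\<in>S. \<Sum>A\<in>permutations_of_set (S - {x}). f (rev A @ [x]))"
    by (simp add: sum.reindex)
  also have "\<dots> = (\<Sum>x\<in>S. \<Sum>A\<in>permutations_of_set (S - {x}). f (A @ [x]))"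
    by (rule sum.cong[OF refl], rule sum.reindex_bij_witness[of _ rev rev])
       (auto simp: permutations_of_set_def)
  finally show ?thesis .
qed

lemma sum_permutations_of_set_rotate1:
  "(\<Sum>A\<in>permutations_of_set S. f (rotate1 A)) = (\<Sum>A\<in>permutations_of_set S. f A)"
proof -
  have inj: "inj_on rotate1 (permutations_of_set S)"
    using inj_rotate1 by (rule inj_on_subset) simp
  have "rotate1 ` permutations_of_set S \<subseteq> permutations_of_set S"
    by (auto simp: permutations_of_set_def)
  then have "rotate1 ` permutations_of_set S = permutations_of_set S"
    by (intro endo_inj_surj inj finite_permutations_of_set)
  then show ?thesis
    using sum.reindex[OF inj, of f] by simp
qed

text \<open>
  When \<open>ys\<close> is a uniformly random permutation of \<open>U \<union> V\<close>, the pair of blocks is uniformly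
  distributed over pairs of permutations of \<open>U\<close> and \<open>V\<close>; the factorials are the normalising
  constants of the two sides.  The proof goes by induction on the number of scanned elements,
  splitting off the last one: if it lies in \<open>U\<close>, it is appended to a uniform \<open>L\<close> while \<open>R\<close> is
  rotated, and if it lies in \<open>V\<close>, it is appended to a uniform \<open>R\<close>.
\<close>

lemma lomuto_split_uniform:
  fixes F :: "'a::linorder list \<Rightarrow> 'a list \<Rightarrow> real"
  assumes "finite U" "finite V" "\<And>x. x \<in> U \<Longrightarrow> x < p" "\<And>x. x \<in> V \<Longrightarrow> p < x"
  shows "fact (card U) * fact (card V) *
      (\<Sum>ys\<in>permutations_of_set (U \<union> V). F (filter (\<lambda>y. y < p) ys) (lomuto_large p ys)) =
      fact (card U + card V) * (\<Sum>L\<in>permutations_of_set U. \<Sum>R\<in>permutations_of_set V. F L R)"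
  using assms
proof (induction "card U + card V" arbitrary: U V F)
  case 0
  then show ?case by simp
next
  case (Suc m)
  let ?g = "\<lambda>F ys. F (filter (\<lambda>y. y < p) ys) (lomuto_large p ys)"
  let ?S = "\<lambda>F U V. (\<Sum>L\<in>permutations_of_set U. \<Sum>R\<in>permutations_of_set V. F L R)"
  let ?c = "fact (card U) * fact (card V) :: real"
  have disj: "U \<inter> V = {}"
    using Suc.prems(3,4) by fastforce
  \<comment> \<open>The factor \<open>card U\<close> comes from \<open>fact (card U) = card U * fact (card (U - {x}))\<close>, where the second
    factor is the one that the induction hypothesis for \<open>U - {x}\<close> needs.\<close>
  have small: "?c * (\<Sum>x\<in>U. \<Sum>ys\<in>permutations_of_set (U \<union> V - {x}). ?g F (ys @ [x])) =
      card U * fact m * ?S F U V"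
  proof (cases "U = {}")
    case False
    have "?c * (\<Sum>ys\<in>permutations_of_set (U \<union> V - {x}). ?g F (ys @ [x])) =
        card U * fact m * (\<Sum>L\<in>permutations_of_set (U - {x}). \<Sum>R\<in>permutations_of_set V. F (L @ [x]) R)"
      if x: "x \<in> U" for x
    proof -
      obtain u where U: "card (U - {x}) = u" "card U = Suc u"
        using card_Suc_Diff1[OF Suc.prems(1) x] by metis
      have eq: "U \<union> V - {x} = (U - {x}) \<union> V"
        using x disj by auto
      have "fact (card (U - {x})) * fact (card V) *
          (\<Sum>ys\<in>permutations_of_set (U \<union> V - {x}). ?g F (ys @ [x])) =
          fact m * ?S (\<lambda>L R. F (L @ [x]) (rotate1 R)) (U - {x}) V"
        unfolding eq
        using Suc.hyps(1)[of "U - {x}" V "\<lambda>L R. F (L @ [x]) (rotate1 R)"] Suc.prems Suc.hyps(2) U x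
        by simp
      also have "\<dots> = fact m * ?S (\<lambda>L R. F (L @ [x]) R) (U - {x}) V"
        using sum_permutations_of_set_rotate1[of "F (L @ [x])" V for L] by simp
      finally show ?thesis
        unfolding U fact_Suc by (simp add: algebra_simps)
    qed
    then show ?thesis
      unfolding sum_permutations_of_set_by_last[OF Suc.prems(1) False]
      by (simp add: sum_distrib_left)
  qed simp
  have large: "?c * (\<Sum>x\<in>V. \<Sum>ys\<in>permutations_of_set (U \<union> V - {x}). ?g F (ys @ [x])) =
      card V * fact m * ?S F U V"
  proof (cases "V = {}")
    case False
    have "?c * (\<Sum>ys\<in>permutations_of_set (U \<union> V - {x}). ?g F (ys @ [x])) =
        card V * fact m * (\<Sum>R\<in>permutations_of_set (V - {x}). \<Sum>L\<in>permutations_of_set U. F L (R @ [x]))"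
      if x: "x \<in> V" for x
    proof -
      obtain v where V: "card (V - {x}) = v" "card V = Suc v"
        using card_Suc_Diff1[OF Suc.prems(2) x] by metis
      have eq: "U \<union> V - {x} = U \<union> (V - {x})"
        using x disj by auto
      have "\<not> x < p"
        using Suc.prems(4)[OF x] by simp
      then have "fact (card U) * fact (card (V - {x})) *
          (\<Sum>ys\<in>permutations_of_set (U \<union> V - {x}). ?g F (ys @ [x])) =
          fact m * ?S (\<lambda>L R. F L (R @ [x])) U (V - {x})"
        unfolding eq
        using Suc.hyps(1)[of U "V - {x}" "\<lambda>L R. F L (R @ [x])"] Suc.prems Suc.hyps(2) V
        by simp
      also have "?S (\<lambda>L R. F L (R @ [x])) U (V - {x}) =
          (\<Sum>R\<in>permutations_of_set (V - {x}). \<Sum>L\<in>permutations_of_set U. F L (R @ [x]))"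
        by (rule sum.swap)
      finally show ?thesis
        unfolding V fact_Suc by (simp add: algebra_simps)
    qed
    then have "?c * (\<Sum>x\<in>V. \<Sum>ys\<in>permutations_of_set (U \<union> V - {x}). ?g F (ys @ [x])) =
        card V * fact m * (\<Sum>R\<in>permutations_of_set V. \<Sum>L\<in>permutations_of_set U. F L R)"
      unfolding sum_permutations_of_set_by_last[OF Suc.prems(2) False]
      by (simp add: sum_distrib_left)
    then show ?thesis
      by (subst sum.swap)
  qed simp
  have nonempty: "finite (U \<union> V)" "U \<union> V \<noteq> {}"
    using Suc.hyps(2) Suc.prems(1,2) by auto
  have "?c * (\<Sum>ys\<in>permutations_of_set (U \<union> V). ?g F ys) =
      (card U + card V) * fact m * ?S F U V"
    using small large
    unfolding sum_permutations_of_set_by_last[OF nonempty] sum.union_disjoint[OF Suc.prems(1,2) disj]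
    by (simp only: distrib_left distrib_right of_nat_add)
  also have "\<dots> = fact (card U + card V) * ?S F U V"
    unfolding Suc.hyps(2)[symmetric] by (simp add: algebra_simps)
  finally show ?case .
qed

section \<open>The recurrence and its solution\<close>

text \<open>
  The number of smaller elements maps \<open>S\<close> bijectively onto the initial segment of length \<open>card S\<close>,
  so a sum over pivots becomes a sum over ranks.
\<close>

lemma sum_over_ranks:
  fixes g :: "nat \<Rightarrow> 'b::comm_monoid_add" and S :: "'a::linorder set"
  assumes "finite S"
  shows "(\<Sum>p\<in>S. g (card {x \<in> S. x < p})) = (\<Sum>k<card S. g k)"
  using assms
proof (induction rule: finite_linorder_max_induct)
  case empty
  then show ?case by simp
next
  case (insert b S)
  then have b: "b \<notin> S" by auto
  have "{x \<in> insert b S. x < p} = {x \<in> S. x < p}" if "p \<in> S" for p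
    using insert.hyps(2) that by auto
  moreover have "{x \<in> insert b S. x < b} = S"
    using insert.hyps(2) by auto
  ultimately show ?case
    using insert b by (simp add: add.commute)
qed

text \<open>
  At \<open>n = 0\<close> and \<open>n = 1\<close> the closed form has the values \<open>-1/3\<close> and \<open>1/3\<close>, so the initial values \<open>0\<close>
  of the recurrence are set separately.
\<close>

definition expected_swaps :: "nat \<Rightarrow> real" where
  "expected_swaps n = (if n < 2 then 0 else (real n + 1) * harm n - 4 / 3 * real n - 1 / 3)"

text \<open>
  The first-order form of the recurrence, as obtained by subtracting its instances at \<open>n + 1\<close>
  and \<open>n\<close>.
\<close>

lemma expected_swaps_Suc:
  assumes "n \<ge> 2"
  shows "(real n + 1) * expected_swaps (Suc n) = (real n + 2) * expected_swaps n + real n + 1"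
  using assms by (simp add: expected_swaps_def harm_Suc field_simps)

lemma expected_swaps_recurrence:
  assumes "n \<ge> 2"
  shows "(\<Sum>k<n. real k + 1 + expected_swaps k + expected_swaps (n - 1 - k)) =
           real n * expected_swaps n"
proof -
  have "2 * (\<Sum>k<n. expected_swaps k) = real n * expected_swaps n - real n * (real n + 1) / 2"
    using assms
  proof (induction n rule: dec_induct)
    case base
    show ?case
      by (simp add: expected_swaps_def harm_expand harm_Suc eval_nat_numeral)
  next
    case (step n)
    then show ?case
      using expected_swaps_Suc[of n] by (simp add: field_simps)
  qed
  moreover have "(\<Sum>k<n. expected_swaps (n - 1 - k)) = (\<Sum>k<n. expected_swaps k)"
    using sum.nat_diff_reindex[of expected_swaps n] by simp
  moreover have "(\<Sum>k<n. real k + 1) = real n * (real n + 1) / 2"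
    by (induction n) (auto simp: field_simps)
  ultimately show ?thesis
    by (simp only: sum.distrib)
qed

text \<open>
  Strong induction on the size: splitting off the last entry amounts to conditioning on the pivot,
  and uniformity of the two blocks turns the recursive costs into instances of the induction
  hypothesis.
\<close>

lemma sum_quicksort_swaps:
  fixes S :: "'a::linorder set"
  assumes "finite S"
  shows "(\<Sum>A\<in>permutations_of_set S. real (quicksort_swaps A)) =
           fact (card S) * expected_swaps (card S)"
  using assms
proof (induction "card S" arbitrary: S rule: less_induct)
  case less
  show ?case
  proof (cases "card S < 2")
    case True
    have "quicksort_swaps A = 0" if "A \<in> permutations_of_set S" for A
      using that True length_finite_permutations_of_set[OF that]
      by (simp add: quicksort_swaps_def lomuto_quicksort.simps)
    then show ?thesis
      using True by (simp add: expected_swaps_def)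
  next
    case False
    define n where "n = card S"
    have n: "n \<ge> 2"
      using False n_def by simp
    let ?e = expected_swaps
    let ?Q = "\<lambda>A. real (quicksort_swaps A)"
    have pivot: "(\<Sum>ys\<in>permutations_of_set (S - {p}). ?Q (ys @ [p])) =
        fact (n - 1) * (real k + 1 + ?e k + ?e (n - 1 - k))"
      if p: "p \<in> S" and k: "k = card {x \<in> S. x < p}" for p k
    proof -
      define U where "U = {x \<in> S. x < p}"
      define V where "V = {x \<in> S. p < x}"
      \<comment> \<open>The final swap of the partition puts the pivot before the large block and rotates that
        block once more.\<close>
      define F :: "'a list \<Rightarrow> 'a list \<Rightarrow> real" where
        "F = (\<lambda>L R. real k + 1 + ?Q L + ?Q (rotate1 R))"
      have fin: "finite U" "finite V"
        using less.prems by (auto simp: U_def V_def)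
      have parts: "S - {p} = U \<union> V" and disj: "U \<inter> V = {}"
        by (auto simp: U_def V_def)
      have card_sum: "card U + card V = n - 1"
        using card_Un_disjoint[OF fin disj] p less.prems by (simp add: n_def flip: parts)
      then have cards: "card U = k" "card V = n - 1 - k"
        using k U_def by auto
      have "U \<subset> S" "V \<subset> S"
        using p by (auto simp: U_def V_def)
      then have IH: "(\<Sum>A\<in>permutations_of_set U. ?Q A) = fact (card U) * ?e (card U)"
        "(\<Sum>A\<in>permutations_of_set V. ?Q A) = fact (card V) * ?e (card V)"
        using less.hyps less.prems fin psubset_card_mono by blast+
      have "?Q (ys @ [p]) = F (filter (\<lambda>y. y < p) ys) (lomuto_large p ys)"
        if ys: "ys \<in> permutations_of_set (U \<union> V)" for ys
      proof -
        have "length ys = n - 1"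
          using length_finite_permutations_of_set[OF ys] p by (simp add: n_def flip: parts)
        then have ne: "ys \<noteq> []"
          using n by auto
        have "distinct (filter (\<lambda>y. y < p) ys)" "set (filter (\<lambda>y. y < p) ys) = U"
          using ys by (auto simp: permutations_of_set_def U_def V_def)
        then have "length (filter (\<lambda>y. y < p) ys) = k"
          using distinct_card cards(1) by metis
        then show ?thesis
          using quicksort_swaps_snoc[OF ne, of p] by (simp add: F_def)
      qed
      then have "fact (card U) * fact (card V) * (\<Sum>ys\<in>permutations_of_set (S - {p}). ?Q (ys @ [p])) =
          fact (card U + card V) * (\<Sum>L\<in>permutations_of_set U. \<Sum>R\<in>permutations_of_set V. F L R)"
        unfolding parts using lomuto_split_uniform[OF fin, of p F] U_def V_def by simp
      also have "(\<Sum>L\<in>permutations_of_set U. \<Sum>R\<in>permutations_of_set V. F L R) =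
          fact (card U) * fact (card V) * (real k + 1 + ?e (card U) + ?e (card V))"
        using fin
        by (simp add: F_def sum.distrib IH sum_permutations_of_set_rotate1[of ?Q V]
              flip: sum_distrib_left) (simp add: algebra_simps)
      finally show ?thesis
        unfolding card_sum unfolding cards by simp
    qed
    have "S \<noteq> {}"
      using n n_def by auto
    then have "(\<Sum>A\<in>permutations_of_set S. ?Q A) =
        (\<Sum>p\<in>S. \<Sum>ys\<in>permutations_of_set (S - {p}). ?Q (ys @ [p]))"
      using less.prems by (intro sum_permutations_of_set_by_last)
    also have "\<dots> = (\<Sum>k<n. fact (n - 1) * (real k + 1 + ?e k + ?e (n - 1 - k)))"
      using pivot sum_over_ranks[OF less.prems,
          of "\<lambda>k. fact (n - 1) * (real k + 1 + ?e k + ?e (n - 1 - k))"]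
      by (simp add: n_def)
    also have "\<dots> = fact (n - 1) * (real n * ?e n)"
      using expected_swaps_recurrence[OF n] by (simp flip: sum_distrib_left)
    also have "\<dots> = fact n * ?e n"
      using n by (simp add: fact_reduce)
    finally show ?thesis
      by (simp add: n_def)
  qed
qed

theorem theorem4p13:
  fixes S :: "'a::linorder set" and n :: nat
  assumes "finite S" and "card S = n" and "n \<ge> 2"
  shows "measure_pmf.expectation (pmf_of_set (permutations_of_set S)) (\<lambda>A. real (quicksort_swaps A))
           = (real n + 1) * harm n - 4 / 3 * real n - 1 / 3"
proof -
  have "measure_pmf.expectation (pmf_of_set (permutations_of_set S)) (\<lambda>A. real (quicksort_swaps A)) =
      (\<Sum>A\<in>permutations_of_set S. real (quicksort_swaps A)) / fact n"
    using assms by (simp add: integral_pmf_of_set)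
  also have "\<dots> = expected_swaps n"
    using assms by (simp add: sum_quicksort_swaps)
  finally show ?thesis
    using assms(3) by (simp add: expected_swaps_def)
qed

end
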